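(* Let $u$ be a positive integer (regarded as a one-letter word). Then a finite word $w$ over the positive integers satisfies $uw\equiv wu$ if and only if every column of the tableau $P(w)$ contains an entry equal to $u$.
   Context: $P(v)$ is the RSK insertion tableau of the word $v$, and $\equiv$ is Knuth equivalence: $v\equiv w$ iff $P(v)=P(w)$ (equivalently, related by Knuth transpositions $xacby\leftrightarrow xcaby$ with $a\le b<c$ and $xbacy\leftrightarrow xbcay$ with $a<b\le c$). The empty word has empty tableau, which vacuously satisfies the column condition. *)

theory Defs
  imports Main
begin

text \<open>Words are lists of natural numbers, and positivity of the letters is a hypothesis where it
  is needed. A tableau is the list of its rows, top row first (English notation).\<close>

text \<open>Row insertion: the leftmost entry strictly greater than \<open>x\<close> is bumped and returned; if there
  is none, \<open>x\<close> is appended.\<close>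
fun row_insert :: "nat \<Rightarrow> nat list \<Rightarrow> nat list \<times> nat option" where
  "row_insert x [] = ([x], None)"
| "row_insert x (y # r) =
     (if x < y then (x # r, Some y)
      else (let (r', b) = row_insert x r in (y # r', b)))"

fun tableau_insert :: "nat \<Rightarrow> nat list list \<Rightarrow> nat list list" where
  "tableau_insert x [] = [[x]]"
| "tableau_insert x (r # t) =
     (case row_insert x r of
        (r', None) \<Rightarrow> r' # t
      | (r', Some y) \<Rightarrow> r' # tableau_insert y t)"

text \<open>The letters of the word are inserted from left to right.\<close>
definition P_tableau :: "nat list \<Rightarrow> nat list list" where
  "P_tableau w = foldl (\<lambda>t x. tableau_insert x t) [] w"

definition knuth_equiv :: "nat list \<Rightarrow> nat list \<Rightarrow> bool" (infix "\<equiv>\<^sub>K" 50) where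
  "v \<equiv>\<^sub>K w \<longleftrightarrow> P_tableau v = P_tableau w"

text \<open>On a left-justified array the library function \<^const>\<open>transpose\<close> allows rows of different
  lengths: its \<open>j\<close>-th list consists of the \<open>j\<close>-th entries of the rows longer than \<open>j\<close>.\<close>
definition tableau_columns :: "nat list list \<Rightarrow> nat list list" where
  "tableau_columns t = transpose t"

end

theory Submission
  imports Defs
begin

text \<open>Let \<open>r\<close> be the first row of \<open>P(w)\<close>. Compare the insertions of \<open>w\<close> and of \<open>uw\<close>. As long as
  every letter \<open>x < u\<close> bumps a letter \<open>\<le> u\<close> from the first row, both bump the same letters and the
  first rows differ by exactly one additional \<open>u\<close>; at the first exception \<open>uw\<close> bumps the additional
  \<open>u\<close>, and from then on the first rows agree on the letters \<open>\<le> u\<close>. The number of letters \<open>\<le> u\<close> in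
  \<open>r\<close> is the number of occurrences of \<open>u\<close> in \<open>w\<close> plus the number of exceptions. Hence
  \<open>uw \<equiv> wu\<close> iff there is no exception and all of \<open>r\<close> is \<open>\<le> u\<close>, that is, iff \<open>u\<close> occurs
  \<open>|r|\<close> times in \<open>w\<close>. As columns are strictly increasing, this says that \<open>u\<close> meets each of the
  \<open>|r|\<close> columns.\<close>

section \<open>First row and content of a tableau under insertion\<close>

definition first_row :: "nat list list \<Rightarrow> nat list" where
  "first_row t = (case t of [] \<Rightarrow> [] | r # _ \<Rightarrow> r)"

lemma first_row_simps [simp]: "first_row [] = []" "first_row (r # t) = r"
  by (simp_all add: first_row_def)

text \<open>The values \<open>first_row [] = []\<close> and \<open>tl [] = []\<close> merge the two
  equations of insertion into one, without a case split on the tableau.\<close>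

lemma tableau_insert_eq:
  "tableau_insert x t = fst (row_insert x (first_row t)) #
     (case snd (row_insert x (first_row t)) of
        None \<Rightarrow> tl t | Some y \<Rightarrow> tableau_insert y (tl t))"
  by (cases t) (auto split: prod.splits option.splits)

lemma first_row_tableau_insert [simp]:
  "first_row (tableau_insert x t) = fst (row_insert x (first_row t))"
  by (simp add: tableau_insert_eq)

lemma P_tableau_Nil [simp]: "P_tableau [] = []"
  by (simp add: P_tableau_def)

lemma P_tableau_snoc [simp]: "P_tableau (w @ [x]) = tableau_insert x (P_tableau w)"
  by (simp add: P_tableau_def)

lemma row_insert_eq:
  "row_insert x r =
     (let k = length (takeWhile (\<lambda>y. y \<le> x) r)
      in if k < length r then (r[k := x], Some (r ! k)) else (r @ [x], None))"
  by (induction r) (auto simp: Let_def)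

lemma row_insert_bumped_gt: "snd (row_insert x r) = Some y \<Longrightarrow> x < y"
  by (induction r) (auto split: if_splits prod.splits)

lemma set_row_insert: "set (fst (row_insert x r)) \<subseteq> insert x (set r)"
  by (induction r) (auto split: if_splits prod.splits)

lemma sorted_row_insert: "sorted r \<Longrightarrow> sorted (fst (row_insert x r))"
proof (induction r)
  case (Cons y r)
  then show ?case
    using set_row_insert[of x r] by (fastforce split: prod.splits)
qed simp

lemma sorted_first_row: "sorted (first_row (P_tableau w))"
  by (induction w rule: rev_induct) (simp_all add: sorted_row_insert)

text \<open>Insertion only moves letters. The instances used below are \<open>\<le> u\<close> (for
  the exceptions), equality with \<open>u\<close>, and constant truth (for row lengths).\<close>

lemma length_filter_row_insert:
  "length (filter p (fst (row_insert x r))) +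
     (case snd (row_insert x r) of None \<Rightarrow> 0 | Some y \<Rightarrow> if p y then 1 else 0) =
   length (filter p r) + (if p x then 1 else 0)"
  by (induction r) (auto split: prod.splits option.splits if_splits)

lemma length_filter_tableau_insert:
  "length (filter p (concat (tableau_insert x t))) =
   length (filter p (concat t)) + (if p x then 1 else 0)"
proof (induction t arbitrary: x)
  case (Cons r t)
  then show ?case
    using length_filter_row_insert[of p x r]
    by (cases "snd (row_insert x r)") (simp_all add: tableau_insert_eq[of x "r # t"] del: tableau_insert.simps)
qed simp

lemma length_filter_P_tableau:
  "length (filter p (concat (P_tableau w))) = length (filter p w)"
  by (induction w rule: rev_induct) (simp_all add: length_filter_tableau_insert)

section \<open>Row insertion relative to a threshold letter\<close>

lemma row_insert_appends:
  assumes "\<forall>y \<in> set r. y \<le> x"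
  shows "row_insert x r = (r @ [x], None)"
  using assms by (induction r) auto

lemma row_insert_None: "snd (row_insert x r) = None \<Longrightarrow> y \<in> set r \<Longrightarrow> y \<le> x"
  by (induction r) (auto split: if_splits prod.splits)

text \<open>In a sorted row the letters \<open>\<le> u\<close> form a prefix, and a letter
  \<open>> u\<close> acts behind it. Hence first rows that agree on the letters
  \<open>\<le> u\<close> keep agreeing under common insertions.\<close>

lemma filter_row_insert:
  assumes "sorted r"
  shows "filter (\<lambda>y. y \<le> u) (fst (row_insert x r)) =
    (if x \<le> u then filter (\<lambda>y. y \<le> u) (fst (row_insert x (filter (\<lambda>y. y \<le> u) r)))
     else filter (\<lambda>y. y \<le> u) r)"
  using assms
proof (induction r)
  case (Cons y r)
  have "filter (\<lambda>y. y \<le> u) r = []" if "u < y"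
    using that Cons.prems by (force simp: filter_empty_conv)
  then show ?case
    using Cons by (auto split: prod.splits)
qed simp

text \<open>No exception: if \<open>u \<le> x\<close>, the additional \<open>u\<close> lies left of
  the place that \<open>x\<close> takes. Otherwise it may be thought of as lying right of the bumped
  \<open>y \<le> u\<close>, since equal letters are indistinguishable.\<close>

lemma row_insert_insort_same:
  assumes "sorted r" and "u \<le> x \<or> (\<exists>y\<le>u. snd (row_insert x r) = Some y)"
  shows "row_insert x (insort u r) =
    (insort u (fst (row_insert x r)), snd (row_insert x r))"
  using assms
proof (induction r)
  case (Cons y r)
  show ?case
  proof (cases "x < y \<or> \<not> u \<le> y")
    case True
    then show ?thesis using Cons by (auto split: prod.splits simp: insort_is_Cons)
  next
    case False
    then have "u \<le> x" and "y \<le> x" by auto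
    then show ?thesis using False Cons by (auto split: prod.splits)
  qed
qed auto

text \<open>The exception: \<open>r\<close> has no letter \<open>z\<close> with
  \<open>x < z \<le> u\<close>, so the additional \<open>u\<close> is the leftmost letter
  \<open>> x\<close> and gives way to \<open>x\<close>. In \<open>r\<close> itself, \<open>x\<close>
  replaces a letter \<open>> u\<close> or is appended.\<close>

lemma filter_row_insert_insort_diff:
  assumes "sorted r" and "x < u" and "\<forall>y. snd (row_insert x r) = Some y \<longrightarrow> u < y"
  shows "filter (\<lambda>y. y \<le> u) (fst (row_insert x (insort u r))) =
    filter (\<lambda>y. y \<le> u) (fst (row_insert x r))"
  using assms
proof (induction r)
  case (Cons y r)
  then show ?case by (auto split: prod.splits)
qed auto

lemma insertion_dichotomy:
  fixes u w
  defines "small \<equiv> \<lambda>t. filter (\<lambda>y. y \<le> u) (first_row t)"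
  shows "P_tableau (u # w) = insort u (first_row (P_tableau w)) # tl (P_tableau w) \<and>
      length (small (P_tableau w)) = length (filter ((=) u) w) \<or>
    small (P_tableau (u # w)) = small (P_tableau w) \<and>
      length (small (P_tableau w)) > length (filter ((=) u) w)"
    (is "?same w \<or> ?diff w")
proof (induction w rule: rev_induct)
  case Nil
  have "P_tableau [u] = [[u]]" using P_tableau_snoc[of "[]" u] by simp
  then show ?case by (simp add: small_def)
next
  case (snoc x w)
  let ?r = "first_row (P_tableau w)"
  let ?b = "snd (row_insert x ?r)"
  have step: "P_tableau (u # w @ [x]) = tableau_insert x (P_tableau (u # w))"
    using P_tableau_snoc[of "u # w" x] by simp
  note srt = sorted_first_row[of w]
  note len = length_filter_row_insert[of "\<lambda>y. y \<le> u" x ?r]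
  have gt: "\<forall>y. ?b = Some y \<longrightarrow> x < y" using row_insert_bumped_gt by blast
  from snoc.IH show ?case
  proof
    assume same: "?same w"
    show ?case
    proof (cases "u \<le> x \<or> (\<exists>y\<le>u. ?b = Some y)")
      case True
      \<comment> \<open>If \<open>u \<le> x\<close>, any bumped letter is \<open>> u\<close>, so the
        left side grows exactly when \<open>x = u\<close>. Otherwise one letter
        \<open>\<le> u\<close> displaces another.\<close>
      have "length (small (P_tableau (w @ [x]))) = length (filter ((=) u) (w @ [x]))"
        using same len gt True
        by (cases ?b) (auto simp: small_def split: if_splits)
      moreover have "P_tableau (u # w @ [x]) =
          insort u (first_row (P_tableau (w @ [x]))) # tl (P_tableau (w @ [x]))"
        using same row_insert_insort_same[OF srt True]
        by (simp add: step tableau_insert_eq[of x "P_tableau w"] tableau_insert_eq[of x "_ # _"]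
            split: option.split)
      ultimately show ?thesis by blast
    next
      case False
      then have fail: "x < u" "\<forall>y. ?b = Some y \<longrightarrow> u < y"
        by (auto simp flip: not_le)
      then have "small (P_tableau (u # w @ [x])) = small (P_tableau (w @ [x]))"
        using same filter_row_insert_insort_diff[OF srt, of x u]
        by (simp add: step small_def del: tableau_insert.simps)
      moreover have "length (small (P_tableau (w @ [x]))) > length (filter ((=) u) (w @ [x]))"
        using same len fail
        by (auto simp: small_def split: option.splits if_splits)
      ultimately show ?thesis by blast
    qed
  next
    assume diff: "?diff w"
    have "small (P_tableau (u # w @ [x])) = small (P_tableau (w @ [x]))"
      using diff filter_row_insert[OF srt, of u x]
        filter_row_insert[OF sorted_first_row[of "u # w"], of u x]
      by (simp add: step small_def del: tableau_insert.simps)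
    \<comment> \<open>The left side never decreases, as only a letter \<open>< u\<close> can bump
      one that is \<open>\<le> u\<close>. For \<open>x = u\<close> both sides grow by one.\<close>
    moreover have "length (small (P_tableau (w @ [x]))) > length (filter ((=) u) (w @ [x]))"
      using diff len gt
      by (cases ?b) (auto simp: small_def split: if_splits)
    ultimately show ?case by blast
  qed
qed

lemma knuth_commute_iff_count:
  "(u # w) \<equiv>\<^sub>K (w @ [u]) \<longleftrightarrow>
    length (filter ((=) u) w) = length (first_row (P_tableau w))"
proof -
  let ?t = "P_tableau w"
  let ?r = "first_row ?t"
  let ?s = "\<lambda>r. filter (\<lambda>y. y \<le> u) r"
  have le: "length (?s ?r) \<le> length ?r" by simp
  have all: "\<forall>y \<in> set ?r. y \<le> u" if "length (?s ?r) = length ?r"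
    using that by (metis length_filter_less less_irrefl)
  show ?thesis
  proof
    assume eq: "(u # w) \<equiv>\<^sub>K (w @ [u])"
    then have row: "first_row (P_tableau (u # w)) = fst (row_insert u ?r)"
      by (simp add: knuth_equiv_def)
    \<comment> \<open>A letter bumped by \<open>u\<close> exceeds \<open>u\<close>. The increase by
      one excludes the second alternative of the dichotomy.\<close>
    have "length (?s (fst (row_insert u ?r))) = length (?s ?r) + 1"
      using length_filter_row_insert[of "\<lambda>y. y \<le> u" u ?r] row_insert_bumped_gt[of u ?r]
      by (auto split: option.splits if_splits)
    with row insertion_dichotomy[of u w]
    have 1: "P_tableau (u # w) = insort u ?r # tl ?t"
      and 2: "length (?s ?r) = length (filter ((=) u) w)"
      by auto
    \<comment> \<open>A bump would preserve the length of the row, whereas \<open>insort\<close>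
      adds one.\<close>
    have "snd (row_insert u ?r) = None"
      using length_filter_row_insert[of "\<lambda>_. True" u ?r] arg_cong[OF row, of length] 1
      by (simp split: option.splits)
    then have "?s ?r = ?r" using row_insert_None by (auto simp: filter_id_conv)
    with 2 show "length (filter ((=) u) w) = length ?r" by simp
  next
    assume eq: "length (filter ((=) u) w) = length ?r"
    with insertion_dichotomy[of u w] le
    have 1: "P_tableau (u # w) = insort u ?r # tl ?t" and 2: "length (?s ?r) = length ?r"
      by (metis linorder_not_less)+
    have "insort u ?r = ?r @ [u]"
      using sorted_first_row[of w] all[OF 2]
      by (intro sorted_insort_is_snoc) auto
    then show "(u # w) \<equiv>\<^sub>K (w @ [u])"
      using 1 row_insert_appends[OF all[OF 2]]
      by (simp add: knuth_equiv_def tableau_insert_eq[of u ?t])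
  qed
qed

section \<open>Strict increase down the columns\<close>

definition row_above :: "nat list \<Rightarrow> nat list \<Rightarrow> bool" where
  "row_above r s \<longleftrightarrow> length s \<le> length r \<and> (\<forall>j < length s. r ! j < s ! j)"

lemma row_above_trans:
  assumes "row_above r s" and "row_above s t"
  shows "row_above r t"
  unfolding row_above_def
proof (intro conjI allI impI)
  show "length t \<le> length r" using assms by (simp add: row_above_def)
next
  fix j assume "j < length t"
  with assms have "r ! j < s ! j" and "s ! j < t ! j" by (simp_all add: row_above_def)
  then show "r ! j < t ! j" by simp
qed

text \<open>Transitivity reduces the condition on all pairs of rows to adjacent ones, which matches
  the recursion of insertion.\<close>

lemma sorted_wrt_above_Cons:
  "sorted_wrt row_above (r # t) \<longleftrightarrow> row_above r (first_row t) \<and> sorted_wrt row_above t"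
  by (cases t) (auto simp: row_above_def[of r "[]"] intro: row_above_trans)

lemma le_takeWhile: "j < length (takeWhile (\<lambda>z. z \<le> x) r) \<Longrightarrow> r ! j \<le> x"
  by (metis nth_mem set_takeWhileD takeWhile_nth)

text \<open>The bumped letter moves weakly left: the entry of \<open>s\<close> below its old place,
  if any, exceeds it, so \<open>m \<le> k\<close>. Above its new place stands an entry
  \<open>\<le> x < y\<close>; in the other columns the upper entry can only decrease.\<close>

lemma row_above_insert:
  assumes "row_above r s" and "snd (row_insert x r) = Some y"
  shows "row_above (fst (row_insert x r)) (fst (row_insert y s))"
proof -
  define k where "k = length (takeWhile (\<lambda>z. z \<le> x) r)"
  define m where "m = length (takeWhile (\<lambda>z. z \<le> y) s)"
  have k: "k < length r" and y: "y = r ! k" and r': "fst (row_insert x r) = r[k := x]"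
    using assms(2) by (auto simp: row_insert_eq[of x r] k_def[symmetric] Let_def split: if_splits)
  have s': "fst (row_insert y s) = (if m < length s then s[m := y] else s @ [y])"
    by (simp add: row_insert_eq m_def Let_def)
  have ml: "m \<le> length s" by (simp add: m_def length_takeWhile_le)
  have xy: "x < y" using assms(2) by (rule row_insert_bumped_gt)
  have small: "r ! j \<le> x" if "j < k" for j
    using le_takeWhile that unfolding k_def by blast
  have "m \<le> k"
  proof (rule ccontr)
    assume "\<not> m \<le> k"
    then have "s ! k \<le> y"
      using le_takeWhile unfolding m_def by (simp add: not_le)
    moreover have "r ! k < s ! k"
      using assms(1) \<open>\<not> m \<le> k\<close> ml by (simp add: row_above_def)
    ultimately show False using y by simp
  qed
  have lt: "r[k := x] ! m < y"
    using \<open>m \<le> k\<close> small[of m] xy k by (cases "m = k") auto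
  have other: "r[k := x] ! j < s ! j" if "j < length s" for j
    using assms(1) that k xy y by (cases "j = k") (auto simp: row_above_def intro: order.strict_trans)
  show ?thesis
    using assms(1) lt other \<open>m \<le> k\<close> k ml unfolding r' s'
    by (auto simp: row_above_def nth_append nth_list_update less_Suc_eq)
qed

lemma row_above_insert_None:
  "row_above r s \<Longrightarrow> snd (row_insert x r) = None \<Longrightarrow> row_above (fst (row_insert x r)) s"
  by (auto simp: row_insert_eq Let_def row_above_def nth_append split: if_splits)

lemma sorted_wrt_above_tableau_insert:
  "sorted_wrt row_above t \<Longrightarrow> sorted_wrt row_above (tableau_insert x t)"
proof (induction t arbitrary: x)
  case (Cons r t)
  then have "row_above r (first_row t)" "sorted_wrt row_above t"
    by (simp_all only: sorted_wrt_above_Cons)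
  then show ?case
    using Cons.IH row_above_insert[of r "first_row t" x] row_above_insert_None[of r "first_row t" x]
    by (subst tableau_insert_eq)
      (auto simp: sorted_wrt_above_Cons simp del: sorted_wrt.simps(2) split: option.split)
qed simp

lemma sorted_wrt_above_P_tableau: "sorted_wrt row_above (P_tableau w)"
  by (induction w rule: rev_induct) (simp_all add: sorted_wrt_above_tableau_insert)

section \<open>Counting letters by columns\<close>

definition column :: "nat list list \<Rightarrow> nat \<Rightarrow> nat list" where
  "column t j = map (\<lambda>r. r ! j) (filter (\<lambda>r. j < length r) t)"

lemma length_row_le:
  "sorted_wrt row_above t \<Longrightarrow> r \<in> set t \<Longrightarrow> length r \<le> length (first_row t)"
  by (cases t) (auto simp: row_above_def)

lemma set_tableau_columns:
  assumes "sorted_wrt row_above t"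
  shows "set (tableau_columns t) = column t ` {..<length (first_row t)}"
proof -
  \<comment> \<open>By \<open>length_transpose\<close>, this \<open>foldr\<close> is the number of
    columns.\<close>
  have "foldr (\<lambda>r. max (length r)) t 0 \<le> n" if "\<forall>r \<in> set t. length r \<le> n" for n
    using that by (induction t) auto
  then have "foldr (\<lambda>r. max (length r)) t 0 \<le> length (first_row t)"
    using length_row_le[OF assms] by blast
  moreover have "length (first_row t) \<le> foldr (\<lambda>r. max (length r)) t 0"
    by (cases t) auto
  ultimately have "length (transpose t) = length (first_row t)"
    by (simp add: length_transpose)
  then show ?thesis
    by (force simp: tableau_columns_def set_conv_nth nth_transpose column_def)
qed

lemma distinct_column:
  assumes "sorted_wrt row_above t"
  shows "distinct (column t j)"
proof -
  have "sorted_wrt (\<lambda>r s. r ! j < s ! j) (filter (\<lambda>r. j < length r) t)"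
    using assms by (induction t) (auto simp: row_above_def)
  then have "sorted_wrt (<) (column t j)"
    by (simp add: column_def sorted_wrt_map)
  then show ?thesis by (simp add: strict_sorted_iff)
qed

text \<open>Double counting of the cells. Any common bound \<open>n\<close> is allowed, so that it
  stays fixed when a row is removed in the induction.\<close>

lemma sum_length_filter_column:
  assumes "\<forall>r \<in> set t. length r \<le> n"
  shows "(\<Sum>j<n. length (filter p (column t j))) = length (filter p (concat t))"
  using assms
proof (induction t)
  case (Cons r t)
  have "length (filter p r) = (\<Sum>j<n. if j < length r \<and> p (r ! j) then 1 else 0)"
  proof -
    have "{j. j < length r \<and> p (r ! j)} = {..<n} \<inter> {j. j < length r \<and> p (r ! j)}"
      using Cons.prems by auto
    then show ?thesis
      by (simp add: length_filter_conv_card sum.If_cases)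
  qed
  moreover have "length (filter p (column (r # t) j)) =
      (if j < length r \<and> p (r ! j) then 1 else 0) + length (filter p (column t j))" for j
    by (simp add: column_def)
  ultimately show ?case
    using Cons by (simp add: sum.distrib)
qed (simp add: column_def)

text \<open>A column has distinct entries and so contains \<open>u\<close> at most once. Thus the
  number of letters \<open>u\<close> in \<open>t\<close> is the number of columns that contain
  \<open>u\<close>.\<close>

lemma columns_contain_iff_count:
  assumes "sorted_wrt row_above t"
  shows "(\<forall>c \<in> set (tableau_columns t). u \<in> set c) \<longleftrightarrow>
    length (filter ((=) u) (concat t)) = length (first_row t)"
proof -
  let ?n = "length (first_row t)"
  have c: "length (filter ((=) u) (column t j)) = (if u \<in> set (column t j) then 1 else 0)" for j
  proof -
    have "length (filter ((=) u) xs) = (if u \<in> set xs then 1 else 0)" if "distinct xs" for xs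
      using that by (induction xs) auto
    then show ?thesis using distinct_column[OF assms] by blast
  qed
  define J where "J = {j \<in> {..<?n}. u \<in> set (column t j)}"
  have "length (filter ((=) u) (concat t)) = card J"
    using sum_length_filter_column[of t ?n "(=) u", symmetric] length_row_le[OF assms]
    by (auto simp only: J_def c card_eq_sum sum.inter_filter[OF finite_lessThan])
  moreover have "card J = ?n \<longleftrightarrow> J = {..<?n}"
  proof
    assume "card J = ?n"
    moreover have "J \<subseteq> {..<?n}" by (auto simp: J_def)
    ultimately show "J = {..<?n}" by (simp add: card_subset_eq)
  qed simp
  moreover have "J = {..<?n} \<longleftrightarrow> (\<forall>c \<in> set (tableau_columns t). u \<in> set c)"
    by (auto simp: J_def set_tableau_columns[OF assms])
  ultimately show ?thesis by simp
qed

theorem theorem3p2: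
  fixes u :: nat and w :: "nat list"
  assumes "u > 0" and "\<forall>x \<in> set w. x > 0"
  shows "(u # w) \<equiv>\<^sub>K (w @ [u]) \<longleftrightarrow> (\<forall>c \<in> set (tableau_columns (P_tableau w)). u \<in> set c)"
  using columns_contain_iff_count[OF sorted_wrt_above_P_tableau, of w u]
  by (simp add: knuth_commute_iff_count length_filter_P_tableau)

end
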